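(* Let $k,n\in\mathbb{N}$. Then $$S(n+k,n)=\sum_{r=1}^k\binom{k-n}{k-r}\binom{k+n}{k+r}S(k+r,r)$$ and $$s(n+k,n)=\sum_{r=1}^k\binom{k-n}{k-r}\binom{k+n}{k+r}s(k+r,r).$$
   Context: $\mathbb{N}$ is the set of positive integers. For $n\in\mathbb{N}$ and $k\in\{0,1,\ldots,n\}$, the unsigned Stirling number of the first kind $s(n,k)$ and the Stirling number of the second kind $S(n,k)$ are defined by $$x(x-1)\cdots(x-n+1)=\sum_{k=0}^n(-1)^{n-k}s(n,k)x^k,\qquad x^n=\sum_{k=0}^nS(n,k)\,x(x-1)\cdots(x-k+1).$$ Binomial coefficients are generalized: for any number $z$ and integer $j\ge 0$, $\binom{z}{j}=\frac{z(z-1)\cdots(z-j+1)}{j!}$ (with $\binom z0=1$); in particular the upper entry may be negative. *)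

theory Defs
  imports Complex_Main "HOL-Combinatorics.Stirling"
begin

text \<open>
  The library defines the Stirling numbers of the first kind (\<open>stirling\<close>, unsigned) and of
  the second kind (\<open>Stirling\<close>) by their recurrences. The two lemmas below show that they are the
  coefficients in the expansion of falling factorials into powers and of powers into falling
  factorials, respectively. Applied to polynomials, these expansions determine the numbers.
\<close>

lemma falling_factorial_stirling:
  fixes x :: "'a::comm_ring_1"
  shows "(\<Prod>i<n. x - of_nat i) = (\<Sum>k=0..n. (-1) ^ (n - k) * of_nat (stirling n k) * x ^ k)"
proof -
  have "(\<Prod>i<n. x - of_nat i) = (\<Prod>i<n. (-1) * (- x + of_nat i))"
    by simp
  also have "\<dots> = (-1) ^ n * pochhammer (- x) n"
    by (simp only: prod.distrib pochhammer_prod) (simp add: atLeast0LessThan)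
  also have "\<dots> = (\<Sum>k\<le>n. (-1) ^ n * (of_nat (stirling n k) * (- x) ^ k))"
    by (simp add: stirling_pochhammer [symmetric] sum_distrib_left)
  also have "\<dots> = (\<Sum>k\<le>n. (-1) ^ (n - k) * of_nat (stirling n k) * x ^ k)"
  proof (rule sum.cong)
    fix k assume "k \<in> {..n}"
    then have "(-1) ^ n = (-1) ^ (n - k) * ((-1) ^ k :: 'a)"
      by (simp flip: power_add)
    moreover have "(- x) ^ k = (-1) ^ k * x ^ k"
      by (rule power_minus)
    moreover have "(-1) ^ k * ((-1) ^ k :: 'a) = 1"
      by (simp flip: power_mult_distrib)
    ultimately show "(-1) ^ n * (of_nat (stirling n k) * (- x) ^ k) =
        (-1) ^ (n - k) * of_nat (stirling n k) * x ^ k"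
      by (simp add: ac_simps)
  qed simp
  finally show ?thesis
    by (simp add: atMost_atLeast0)
qed

lemma power_Stirling:
  fixes x :: "'a::comm_ring_1"
  shows "x ^ n = (\<Sum>k=0..n. of_nat (Stirling n k) * (\<Prod>i<k. x - of_nat i))"
proof (induction n)
  case 0
  then show ?case by simp
next
  case (Suc n)
  let ?f = "\<lambda>k. \<Prod>i<k. x - of_nat i"
  let ?S = "\<lambda>n k. of_nat (Stirling n k) :: 'a"
  have step: "x * ?f k = ?f (Suc k) + of_nat k * ?f k" for k
    by (simp add: algebra_simps)
  have "x ^ Suc n = (\<Sum>k\<le>n. ?S n k * (x * ?f k))"
    by (simp add: Suc.IH sum_distrib_left atMost_atLeast0 mult.left_commute)
  also have "\<dots> = (\<Sum>k\<le>n. ?S n k * ?f (Suc k)) + (\<Sum>k\<le>n. of_nat k * ?S n k * ?f k)"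
    by (simp only: step distrib_left sum.distrib ac_simps)
  also have "(\<Sum>k\<le>n. of_nat k * ?S n k * ?f k) = (\<Sum>k\<le>Suc n. of_nat k * ?S n k * ?f k)"
    by simp
  also have "\<dots> = (\<Sum>k\<le>n. of_nat (Suc k) * ?S n (Suc k) * ?f (Suc k))"
    by (subst sum.atMost_Suc_shift) simp
  also have "(\<Sum>k\<le>n. ?S n k * ?f (Suc k)) + \<dots> = (\<Sum>k\<le>n. ?S (Suc n) (Suc k) * ?f (Suc k))"
    by (simp only: Stirling.simps of_nat_add of_nat_mult distrib_right sum.distrib add.commute)
  also have "\<dots> = (\<Sum>k\<le>Suc n. ?S (Suc n) k * ?f k)"
    by (subst sum.atMost_Suc_shift) simp
  finally show ?case
    by (simp only: atMost_atLeast0)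
qed

end

theory Submission
  imports Defs "HOL-Computational_Algebra.Polynomial"
begin

text \<open>
  For fixed \<open>k \<ge> 1\<close>, both \<open>S(n + k, n)\<close> and \<open>s(n + k, n)\<close> are polynomials in \<open>n\<close> of degree at
  most \<open>2 * k\<close>, because their backward differences in \<open>n\<close> are linear multiples of the same
  quantities for \<open>k - 1\<close>. Continuing the recurrences to negative arguments shows that these
  polynomials vanish at \<open>0, -1, \<dots>, -k\<close>. The claimed identity is Lagrange interpolation at the
  \<open>2 * k + 1\<close> nodes \<open>-k, \<dots>, k\<close>: the product of the two binomial coefficients is the Lagrange
  basis polynomial that is 1 at \<open>r\<close> and 0 at all other nodes.
\<close>

text \<open>Induction on the degree bound: the backward difference of \<open>x ^ (m + 1)\<close> has
  leading term \<open>(m + 1) * x ^ m\<close>, so a suitable multiple of it removes the top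
  coefficient of \<open>p\<close>.\<close>

lemma backward_antidifference_exists:
  fixes p :: "'a::field_char_0 poly"
  assumes "degree p < m"
  obtains q where "degree q \<le> m" "poly q 0 = 0" "\<And>x. poly q x - poly q (x - 1) = poly p x"
proof -
  \<comment> \<open>Vanishing coefficients replace \<open>degree p < m\<close>, which the zero
    polynomial violates at \<open>m = 0\<close>.\<close>
  have "\<exists>q. degree q \<le> m \<and> poly q 0 = 0 \<and> (\<forall>x. poly q x - poly q (x - 1) = poly p x)"
    if "\<And>i. i \<ge> m \<Longrightarrow> coeff p i = 0" for p :: "'a poly" and m
    using that
  proof (induction m arbitrary: p)
    case 0
    then have "p = 0"
      by (simp add: poly_eq_iff)
    then show ?case
      by (intro exI[of _ 0]) simp
  next
    case (Suc m)
    define a where "a = coeff p m / of_nat (Suc m)"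
    \<comment> \<open>\<open>d\<close> is the backward difference of \<open>a * x ^ Suc m\<close>:
      its \<open>Suc m\<close> coefficients cancel, and \<open>a\<close> makes its coefficient at
      \<open>m\<close> equal to that of \<open>p\<close>.\<close>
    define d where "d = smult a (monom 1 (Suc m) - [:-1, 1:] ^ Suc m)"
    have "coeff (p - d) i = 0" if "i \<ge> m" for i
    proof (cases "i = m")
      case True
      have "coeff d m = a * of_nat (Suc m)"
        by (simp add: d_def coeff_linear_poly_power del: power_Suc)
      with True show ?thesis
        by (simp add: a_def del: of_nat_Suc)
    next
      case False
      with that have i: "i \<ge> Suc m"
        by simp
      have "coeff d i = 0"
      proof (cases "i = Suc m")
        case True
        then show ?thesis
          by (simp add: d_def coeff_linear_poly_power del: power_Suc)
      next
        case False
        with i have "coeff ([:-1, 1 :: 'a:] ^ Suc m) i = 0"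
          by (intro coeff_eq_0) (simp only: degree_linear_power)
        with False show ?thesis
          by (simp add: d_def del: power_Suc)
      qed
      then show ?thesis
        using Suc.prems[OF i] by simp
    qed
    from Suc.IH[OF this] obtain q where q: "degree q \<le> m" "poly q 0 = 0"
      "\<And>x. poly q x - poly q (x - 1) = poly (p - d) x"
      by blast
    have "degree (q + monom a (Suc m)) \<le> Suc m"
      using q(1) by (intro degree_add_le) (simp_all add: degree_monom_le)
    moreover have "poly (q + monom a (Suc m)) 0 = 0"
      using q(2) by (simp add: poly_monom)
    moreover have "poly (q + monom a (Suc m)) x - poly (q + monom a (Suc m)) (x - 1) = poly p x"
      for x
    proof -
      have "poly d x = a * x ^ Suc m - a * (x - 1) ^ Suc m"
        unfolding d_def poly_smult poly_diff poly_power poly_monom by (simp add: algebra_simps)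
      with q(3)[of x] have "poly q x - poly q (x - 1) = poly p x - (a * x ^ Suc m - a * (x - 1) ^ Suc m)"
        by (simp only: poly_diff)
      then show ?thesis
        by (simp add: poly_monom algebra_simps)
    qed
    ultimately show ?case
      by blast
  qed
  with assms that show ?thesis
    by (metis coeff_eq_0 order_less_le_trans)
qed

text \<open>
  The Stirling numbers \<open>F k n = S(n + k, n)\<close> satisfy this recurrence with \<open>c = 0\<close>, and
  \<open>F k n = s(n + k, n)\<close> satisfy it with \<open>c = 1\<close>.
\<close>

lemma stirling_type_polynomial:
  fixes F :: "nat \<Rightarrow> nat \<Rightarrow> 'a::field_char_0"
  assumes F_0: "\<And>n. F 0 n = 1"
    and F_Suc_0: "\<And>k. F (Suc k) 0 = 0"
    and F_Suc_Suc: "\<And>k n. F (Suc k) (Suc n) = F (Suc k) n + (of_nat (Suc n) + c * of_nat k) * F k (Suc n)"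
  obtains p where "degree p \<le> 2 * k" "\<And>n. poly p (of_nat n) = F k n"
    "\<And>j. k \<ge> 1 \<Longrightarrow> j \<le> k \<Longrightarrow> poly p (- of_nat j) = 0"
proof -
  have "\<exists>p. degree p \<le> 2 * k \<and> (\<forall>n. poly p (of_nat n) = F k n) \<and>
      (k \<ge> 1 \<longrightarrow> (\<forall>j\<le>k. poly p (- of_nat j) = 0))"
  proof (induction k)
    case 0
    show ?case
      by (intro exI[of _ 1]) (simp add: F_0)
  next
    case (Suc k)
    then obtain p where p: "degree p \<le> 2 * k" "\<And>n. poly p (of_nat n) = F k n"
      "\<And>j. k \<ge> 1 \<Longrightarrow> j \<le> k \<Longrightarrow> poly p (- of_nat j) = 0"
      by blast
    \<comment> \<open>This is the term \<open>(x + c * k) * p(x)\<close> by which the recurrence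
      says \<open>F (Suc k)\<close> grows from \<open>x - 1\<close> to \<open>x\<close>. Its degree
      is at most \<open>2 * k + 1\<close>.\<close>
    let ?p = "[:c * of_nat k, 1:] * p"
    have "degree ?p \<le> degree [:c * of_nat k, 1:] + degree p"
      by (rule degree_mult_le)
    then have "degree ?p < 2 * Suc k"
      using p(1) by simp
    then obtain q where q: "degree q \<le> 2 * Suc k" "poly q 0 = 0"
      "\<And>x. poly q x - poly q (x - 1) = poly ?p x"
      by (rule backward_antidifference_exists) blast
    have "poly q (of_nat n) = F (Suc k) n" for n
    proof (induction n)
      case 0
      show ?case
        by (simp add: q(2) F_Suc_0)
    next
      case (Suc n)
      then show ?case
        using q(3)[of "of_nat (Suc n)"] p(2)[of "Suc n"]
        by (simp add: F_Suc_Suc algebra_simps)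
    qed
    moreover have "poly q (- of_nat j) = 0" if "j \<le> Suc k" for j
      using that
    proof (induction j)
      case 0
      show ?case
        by (simp add: q(2))
    next
      case (Suc j)
      \<comment> \<open>For \<open>k = 0\<close> necessarily \<open>j = 0\<close>, and the linear
        factor, which is then \<open>x\<close>, vanishes; otherwise \<open>p\<close> does.\<close>
      have "poly ?p (- of_nat j) = 0"
        using p(3)[of j] Suc.prems by (cases "k = 0") simp_all
      then have "poly q (- of_nat j - 1) = poly q (- of_nat j)"
        using q(3)[of "- of_nat j"] by (simp only: right_minus_eq)
      moreover have "- of_nat (Suc j) = - of_nat j - (1 :: 'a)"
        by simp
      ultimately show ?case
        using Suc by (simp only: Suc_leD)
    qed
    ultimately show ?case
      using q(1) by blast
  qed
  with that show ?thesis
    by blast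
qed

lemma gbinomial_linear_polynomial:
  fixes a b :: "'a::field_char_0"
  obtains p where "degree p \<le> m" "\<And>x. poly p x = (a + b * x) gchoose m"
proof
  let ?p = "smult (1 / fact m) (\<Prod>i=0..<m. [:a - of_nat i, b:])"
  have "degree (\<Prod>i=0..<m. [:a - of_nat i, b:]) \<le> (\<Sum>i=0..<m. degree [:a - of_nat i, b:])"
    using degree_prod_sum_le[of "{0..<m}" "\<lambda>i. [:a - of_nat i, b:]"] by (simp add: o_def)
  also have "\<dots> \<le> (\<Sum>i=0..<m. 1)"
    by (intro sum_mono) simp
  finally show "degree ?p \<le> m"
    by simp
  show "poly ?p x = (a + b * x) gchoose m" for x
    by (simp add: gbinomial_prod_rev poly_prod algebra_simps)
qed

text \<open>In the Lagrange formula the nodes \<open>0, -1, ..., -k\<close> contribute nothing,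
  since the interpolated polynomial vanishes there; hence the sum starts at
  \<open>r = 1\<close>.\<close>

lemma stirling_type_interpolation:
  fixes F :: "nat \<Rightarrow> nat \<Rightarrow> 'a::field_char_0"
  assumes "\<And>n. F 0 n = 1"
    and "\<And>k. F (Suc k) 0 = 0"
    and "\<And>k n. F (Suc k) (Suc n) = F (Suc k) n + (of_nat (Suc n) + c * of_nat k) * F k (Suc n)"
    and k: "k \<ge> 1"
  shows "F k n = (\<Sum>r=1..k. ((of_nat k - of_nat n) gchoose (k - r)) *
    of_nat ((k + n) choose (k + r)) * F k r)"
proof -
  from assms(1-3) obtain p where p: "degree p \<le> 2 * k" "\<And>n. poly p (of_nat n) = F k n"
    "\<And>j. j \<le> k \<Longrightarrow> poly p (- of_nat j) = 0"
    by (rule stirling_type_polynomial[of F c k]) (use k in blast)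
  have "\<exists>l :: 'a poly. degree l \<le> 2 * k \<and>
      (\<forall>x. poly l x = ((of_nat k - x) gchoose (k - r)) * ((of_nat k + x) gchoose (k + r)))"
    if "r \<le> k" for r
  proof -
    obtain u :: "'a poly" where u: "degree u \<le> k - r"
      "\<And>x. poly u x = (of_nat k + (-1) * x) gchoose (k - r)"
      by (rule gbinomial_linear_polynomial) blast
    obtain v :: "'a poly" where v: "degree v \<le> k + r"
      "\<And>x. poly v x = (of_nat k + 1 * x) gchoose (k + r)"
      by (rule gbinomial_linear_polynomial) blast
    have "degree (u * v) \<le> 2 * k"
      using degree_mult_le[of u v] u(1) v(1) that by linarith
    then show ?thesis
      by (intro exI[of _ "u * v"]) (simp add: u(2) v(2))
  qed
  then obtain l :: "nat \<Rightarrow> 'a poly" where l: "\<And>r. r \<le> k \<Longrightarrow> degree (l r) \<le> 2 * k"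
    "\<And>r x. r \<le> k \<Longrightarrow> poly (l r) x =
        ((of_nat k - x) gchoose (k - r)) * ((of_nat k + x) gchoose (k + r))"
    by metis
  define q where "q = (\<Sum>r=1..k. smult (F k r) (l r))"
  have l_nat: "poly (l r) (of_nat m) =
      ((of_nat k - of_nat m) gchoose (k - r)) * of_nat ((k + m) choose (k + r))"
    if "r \<le> k" for r m
    using that by (simp add: l(2) binomial_gbinomial)
  \<comment> \<open>The first binomial vanishes for \<open>m > r\<close>, the second for
    \<open>m < r\<close>, and both are 1 for \<open>m = r\<close>.\<close>
  have l_node: "poly (l r) (of_nat m) = (if r = m then 1 else 0)" if "r \<le> k" "m \<le> k" for r m
  proof -
    have "of_nat k - of_nat m = (of_nat (k - m) :: 'a)"
      using that by (simp add: of_nat_diff)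
    then have "poly (l r) (of_nat m) =
        of_nat ((k - m) choose (k - r)) * of_nat ((k + m) choose (k + r))"
      using that by (simp add: l_nat binomial_gbinomial)
    then show ?thesis
      using that by (cases r m rule: linorder_cases) (simp_all add: binomial_eq_0)
  qed
  have "p = q"
  proof (rule poly_eqI_degree)
    let ?A = "of_int ` {- int k..int k} :: 'a set"
    have "card ?A = card {- int k..int k}"
      by (rule card_image) (simp add: inj_on_def)
    then have card: "card ?A > 2 * k"
      by simp
    then show "degree p < card ?A"
      using p(1) by linarith
    have "degree q \<le> 2 * k"
      unfolding q_def by (intro degree_sum_le order.trans[OF degree_smult_le l(1)]) auto
    then show "degree q < card ?A"
      using card by linarith
    fix x assume "x \<in> ?A"
    then obtain i where i: "x = of_int i" "- int k \<le> i" "i \<le> int k"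
      by auto
    show "poly p x = poly q x"
    proof (cases "i \<ge> 1")
      case True
      define m where "m = nat i"
      with i True have m: "x = of_nat m" "m \<in> {1..k}"
        by auto
      have "poly q x = (\<Sum>r=1..k. if r = m then F k r else 0)"
        unfolding q_def poly_sum using m by (intro sum.cong) (auto simp: l_node)
      also have "\<dots> = F k m"
        using m(2) by simp
      finally show ?thesis
        by (simp add: p(2) m(1))
    next
      case False
      define j where "j = nat (- i)"
      with i False have "i = - int j" "j \<le> k"
        by auto
      with i have j: "x = - of_nat j" "j \<le> k"
        by simp_all
      \<comment> \<open>Here the second binomial has the natural number \<open>k - j\<close> as
        upper entry, which is below \<open>k + r\<close> because \<open>r\<close> is
        positive.\<close>
      have "poly (l r) x = 0" if "r \<in> {1..k}" for r
      proof -
        have "of_nat k + x = of_nat (k - j)"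
          using j by (simp add: of_nat_diff)
        moreover have "k - j < k + r"
          using that by auto
        then have "(of_nat (k - j) :: 'a) gchoose (k + r) = 0"
          by (simp flip: binomial_gbinomial add: binomial_eq_0)
        ultimately show ?thesis
          using that by (simp add: l(2))
      qed
      then have "poly q x = 0"
        unfolding q_def poly_sum by (intro sum.neutral) simp
      then show ?thesis
        using p(3) j by simp
    qed
  qed
  \<comment> \<open>Now \<open>n\<close> may exceed \<open>k\<close>, so the upper entry
    \<open>k - n\<close> can be negative.\<close>
  then have "F k n = poly q (of_nat n)"
    by (simp flip: p(2))
  also have "\<dots> = (\<Sum>r=1..k. ((of_nat k - of_nat n) gchoose (k - r)) *
      of_nat ((k + n) choose (k + r)) * F k r)"
    unfolding q_def poly_sum by (intro sum.cong) (auto simp: l_nat)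
  finally show ?thesis .
qed

theorem theorem2p3:
  fixes k n :: nat
  assumes "k \<ge> 1" and "n \<ge> 1"
  shows "(real (Stirling (n + k) n) =
      (\<Sum>r=1..k. ((real k - real n) gchoose (k - r)) * real ((k + n) choose (k + r))
                 * real (Stirling (k + r) r)))
    \<and> (real (stirling (n + k) n) =
      (\<Sum>r=1..k. ((real k - real n) gchoose (k - r)) * real ((k + n) choose (k + r))
                 * real (stirling (k + r) r)))"
proof
  have "real (Stirling (k + n) n) =
      (\<Sum>r=1..k. ((real k - real n) gchoose (k - r)) * real ((k + n) choose (k + r))
                 * real (Stirling (k + r) r))"
    by (rule stirling_type_interpolation[where c = 0 and F = "\<lambda>k n. real (Stirling (k + n) n)"])
      (use assms in \<open>simp_all add: algebra_simps\<close>)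
  then show "real (Stirling (n + k) n) =
      (\<Sum>r=1..k. ((real k - real n) gchoose (k - r)) * real ((k + n) choose (k + r))
                 * real (Stirling (k + r) r))"
    by (simp add: add.commute)
  \<comment> \<open>The recurrence of the first kind multiplies by the upper index
    \<open>k + n + 1\<close> instead of the lower index \<open>n + 1\<close>, whence
    \<open>c = 1\<close>.\<close>
  have "real (stirling (k + n) n) =
      (\<Sum>r=1..k. ((real k - real n) gchoose (k - r)) * real ((k + n) choose (k + r))
                 * real (stirling (k + r) r))"
    by (rule stirling_type_interpolation[where c = 1 and F = "\<lambda>k n. real (stirling (k + n) n)"])
      (use assms in \<open>simp_all add: algebra_simps\<close>)
  then show "real (stirling (n + k) n) =
      (\<Sum>r=1..k. ((real k - real n) gchoose (k - r)) * real ((k + n) choose (k + r))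
                 * real (stirling (k + r) r))"
    by (simp add: add.commute)
qed

end
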